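(* For every even positive integer $d$ there exist a polytope $\mathcal{P} = \{\vec x \in \mathbb{R}^d : A\vec x \le \vec b\}$ with $2d$ facets and a convex quadratic polynomial $f\colon \mathbb{R}^d\to\mathbb{R}$ such that, for some starting vertex $\vec x$ of $\mathcal{P}$, the active-set method $\textsc{ActiveSet}(f,A,\vec b,\vec x)$ needs $2^d$ iterations to maximize $f$ over $\mathcal{P}$, irrespective of the pivot rule.
   Context: The active-set method $\textsc{ActiveSet}(f,A,\vec b,\vec x)$, for a continuously differentiable $f\colon\mathbb{R}^n\to\mathbb{R}$, a bounded polytope $\mathcal{P}=\{\vec y: A\vec y\le \vec b\}$ ($A\in\mathbb{Q}^{m\times n}$, $\vec b\in\mathbb{Q}^m$) and a starting point $\vec x\in\mathcal{P}$, works as follows. For $\vec x\in\mathcal P$ let $\mathrm{Eq}(\vec x)$ be the set of indices of constraints tight at $\vec x$. Initialize the active set $\mathcal A\gets \mathrm{Eq}(\vec x)$. While the set $\mathcal D:=\{\vec d : A_{\mathrm{Eq}(\vec x)\cdot}\vec d\le \vec 0,\ \nabla f(\vec x)^\top\vec d>0\}$ is nonempty, perform one iteration: choose $\vec d\in\mathcal D$ maximizing $|\{i\in\mathcal A: A_{i\cdot}\vec d=0\}|$; if $A_{\mathcal A\cdot}\vec d\ne\vec 0$, remove from $\mathcal A$ some $i\in\mathcal A$ with $A_{i\cdot}\vec d<0$; if $A_{\mathcal A\cdot}\vec d=\vec 0$, set $\mu\gets\inf\{\mu\ge 0: \vec x+\mu\vec d\notin\mathcal P \text{ or } \nabla f(\vec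 x+\mu\vec d)^\top\vec d\le 0\}$, update $\vec x\gets\vec x+\mu\vec d$, and if still $\nabla f(\vec x)^\top\vec d>0$, add to $\mathcal A$ some $j\in\mathrm{Eq}(\vec x)\setminus\mathcal A$. The output is the final $\vec x$. A pivot rule is any rule resolving the choices of $\vec d$, $i$ and $j$ when several are possible; "irrespective of the pivot rule" means the bound holds for every such rule. The number of iterations is the number of executions of the loop body. *)

theory Defs
  imports "HOL-Analysis.Analysis"
begin

definition feasible :: "real^'n^'m \<Rightarrow> real^'m \<Rightarrow> (real^'n) set" where
  "feasible A b = {y. \<forall>i. (A *v y) $ i \<le> b $ i}"

definition tight :: "real^'n^'m \<Rightarrow> real^'m \<Rightarrow> real^'n \<Rightarrow> 'm set" where
  "tight A b x = {i. (A *v x) $ i = b $ i}"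

definition gradient :: "(real^'n \<Rightarrow> real) \<Rightarrow> real^'n \<Rightarrow> real^'n" where
  "gradient f x = (THE g. GDERIV f x :> g)"

(* The degree is exactly 2: for symmetric Q, the quadratic part x \<bullet> (Q *v x)
   vanishes identically only if Q = 0. *)
definition quadratic_polynomial :: "(real^'n \<Rightarrow> real) \<Rightarrow> bool" where
  "quadratic_polynomial f \<longleftrightarrow>
    (\<exists>(Q :: real^'n^'n) q c. transpose Q = Q \<and> Q \<noteq> 0 \<and>
       f = (\<lambda>x. x \<bullet> (Q *v x) + q \<bullet> x + c))"

definition improving_directions ::
  "(real^'n \<Rightarrow> real) \<Rightarrow> real^'n^'m \<Rightarrow> real^'m \<Rightarrow> real^'n \<Rightarrow> (real^'n) set" where
  "improving_directions f A b x =
    {d. (\<forall>i \<in> tight A b x. (A *v d) $ i \<le> 0) \<and> gradient f x \<bullet> d > 0}"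

definition step_length ::
  "(real^'n \<Rightarrow> real) \<Rightarrow> real^'n^'m \<Rightarrow> real^'m \<Rightarrow> real^'n \<Rightarrow> real^'n \<Rightarrow> real" where
  "step_length f A b x d =
    Inf {\<mu>. \<mu> \<ge> 0 \<and> (x + \<mu> *\<^sub>R d \<notin> feasible A b \<or> gradient f (x + \<mu> *\<^sub>R d) \<bullet> d \<le> 0)}"

definition move ::
  "(real^'n \<Rightarrow> real) \<Rightarrow> real^'n^'m \<Rightarrow> real^'m \<Rightarrow> real^'n \<Rightarrow> real^'n \<Rightarrow> real^'n" where
  "move f A b x d = x + step_length f A b x d *\<^sub>R d"

(* A state is the current point together with the active set. *)
type_synonym ('n, 'm) state = "(real^'n) \<times> 'm set"

(* The choices made in one iteration: the direction d, the index i to remove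
   and the index j to add.  Each iteration uses at most one of i and j; an index
   that is not used is irrelevant. *)
type_synonym ('n, 'm) choice = "(real^'n) \<times> 'm \<times> 'm"

fun admissible_choice ::
  "(real^'n \<Rightarrow> real) \<Rightarrow> real^'n^'m \<Rightarrow> real^'m \<Rightarrow> ('n, 'm) state \<Rightarrow> ('n, 'm) choice \<Rightarrow> bool" where
  "admissible_choice f A b (x, \<A>) (d, i, j) \<longleftrightarrow>
     is_arg_max (\<lambda>e. card {k \<in> \<A>. (A *v e) $ k = 0})
       (\<lambda>e. e \<in> improving_directions f A b x) d \<and>
     (if \<exists>k\<in>\<A>. (A *v d) $ k \<noteq> 0
      then i \<in> \<A> \<and> (A *v d) $ i < 0
      else gradient f (move f A b x d) \<bullet> d > 0 \<longrightarrow> j \<in> tight A b (move f A b x d) - \<A>)"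

fun iteration ::
  "(real^'n \<Rightarrow> real) \<Rightarrow> real^'n^'m \<Rightarrow> real^'m \<Rightarrow> ('n, 'm) choice \<Rightarrow> ('n, 'm) state \<Rightarrow> ('n, 'm) state" where
  "iteration f A b (d, i, j) (x, \<A>) =
     (if \<exists>k\<in>\<A>. (A *v d) $ k \<noteq> 0
      then (x, \<A> - {i})
      else (move f A b x d,
            if gradient f (move f A b x d) \<bullet> d > 0 then insert j \<A> else \<A>))"

(* A pivot rule may depend on the entire history: it receives the list of all
   states so far, whose last element is the current state.  Since it only has to
   make an admissible choice where there is one, pivot rules always exist. *)
definition pivot_rule ::
  "(real^'n \<Rightarrow> real) \<Rightarrow> real^'n^'m \<Rightarrow> real^'m \<Rightarrow> (('n, 'm) state list \<Rightarrow> ('n, 'm) choice) \<Rightarrow> bool" where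
  "pivot_rule f A b R \<longleftrightarrow>
    (\<forall>h. h \<noteq> [] \<longrightarrow> (\<exists>c. admissible_choice f A b (last h) c) \<longrightarrow>
       admissible_choice f A b (last h) (R h))"

(* The loop condition is not checked here but in active_set_terminates; only the
   states up to termination are meaningful. *)
primrec active_set_history ::
  "(real^'n \<Rightarrow> real) \<Rightarrow> real^'n^'m \<Rightarrow> real^'m \<Rightarrow> (('n, 'm) state list \<Rightarrow> ('n, 'm) choice) \<Rightarrow>
   real^'n \<Rightarrow> nat \<Rightarrow> ('n, 'm) state list" where
  "active_set_history f A b R x 0 = [(x, tight A b x)]"
| "active_set_history f A b R x (Suc k) =
    (let h = active_set_history f A b R x k in h @ [iteration f A b (R h) (last h)])"

definition active_set_point ::
  "(real^'n \<Rightarrow> real) \<Rightarrow> real^'n^'m \<Rightarrow> real^'m \<Rightarrow> (('n, 'm) state list \<Rightarrow> ('n, 'm) choice) \<Rightarrow>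
   real^'n \<Rightarrow> nat \<Rightarrow> real^'n" where
  "active_set_point f A b R x k = fst (last (active_set_history f A b R x k))"

(* With pivot rule R and starting point x, the method executes the loop body
   exactly N times and outputs y. *)
definition active_set_terminates ::
  "(real^'n \<Rightarrow> real) \<Rightarrow> real^'n^'m \<Rightarrow> real^'m \<Rightarrow> (('n, 'm) state list \<Rightarrow> ('n, 'm) choice) \<Rightarrow>
   real^'n \<Rightarrow> nat \<Rightarrow> real^'n \<Rightarrow> bool" where
  "active_set_terminates f A b R x N y \<longleftrightarrow>
     (\<forall>k<N. improving_directions f A b (active_set_point f A b R x k) \<noteq> {}) \<and>
     improving_directions f A b (active_set_point f A b R x N) = {} \<and>
     y = active_set_point f A b R x N"

end

(* P is a Klee-Minty cube: eps x_{i-1} <= x_i <= 1 - eps x_{i-1} for i = 1..n, with x_0 = 0.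
   The linear functional given by y_0 = 0 and y_i = x_i - eps x_{i-1} + eps^2 y_{i-1} satisfies
   y_n >= x_n^2 on P, with equality at the vertices.  So (x_n, y_n)
   projects P onto a polygon inscribed in the parabola y = x^2 in such a way that all 2^n
   vertices survive.  For f = x_n^2 + c x_n - y_n and two points of the parabola with
   abscissas s and t, the slope of f at s towards t is (t - s)(c - (t - s)), so an edge of P is
   improving iff it raises x_n by a positive amount less than c.  For eps < 1/2 close to 1/2 and
   c = 2^(1-n) there is such an edge at every vertex with x_n < 1.  Hence x_n climbs from 0 to 1
   in steps smaller than c, which takes more than 2^(n-1) edges, and every edge costs the
   active-set method two iterations: one that removes a constraint and one that moves. *)

theory Submission
  imports Defs
begin

section \<open>Gradients, and facets of irredundant systems of inequalities\<close>

lemma gradient_eq: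
  assumes "GDERIV f x :> g"
  shows "gradient f x = g"
  unfolding gradient_def
proof (rule the_equality[of "\<lambda>g. GDERIV f x :> g", OF assms])
  fix h assume "GDERIV f x :> h"
  then have "(\<lambda>v. v \<bullet> h) = (\<lambda>v. v \<bullet> g)"
    using assms unfolding gderiv_def by (rule has_derivative_unique)
  then show "h = g"
    by (metis vector_eq_ldot)
qed

lemma feasible_eq_INT: "feasible A b = (\<Inter>r. {x. A $ r \<bullet> x \<le> b $ r})"
  by (auto simp: feasible_def matrix_vector_mul_component)

lemma polyhedron_feasible: "polyhedron (feasible A b)"
  unfolding feasible_eq_INT by (rule polyhedron_Inter) (auto intro: polyhedron_halfspace_le)

text \<open>The inner point \<open>w\<close> makes the polyhedron full-dimensional, so the rows of
  an irredundant system cut out exactly its facets. A point \<open>z\<close> violating row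
  \<open>r\<close> alone shows that \<open>r\<close> cannot be dropped, and also that different rows
  give different facets.\<close>

lemma card_facets_feasible:
  fixes A :: "real^'n^'m"
  assumes inner: "\<And>r. (A *v w) $ r < b $ r"
    and irredundant: "\<And>r. \<exists>z. b $ r < (A *v z) $ r \<and> (\<forall>s. s \<noteq> r \<longrightarrow> (A *v z) $ s < b $ s)"
  shows "card {F. F facet_of feasible A b} = CARD('m)"
proof -
  define H where "H = (\<lambda>r. {x. A $ r \<bullet> x \<le> b $ r})"
  have row: "(A *v x) $ r = A $ r \<bullet> x" for x r
    by (simp add: matrix_vector_mul_component)
  have P: "feasible A b = \<Inter>(range H)"
    by (simp add: feasible_eq_INT H_def)
  have inj: "inj H"
  proof (rule injI, rule ccontr)
    fix r s assume "H r = H s" "r \<noteq> s"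
    obtain z where "b $ r < (A *v z) $ r" "\<forall>s. s \<noteq> r \<longrightarrow> (A *v z) $ s < b $ s"
      using irredundant by blast
    then have "z \<in> H s" "z \<notin> H r"
      using \<open>r \<noteq> s\<close> by (auto simp: H_def row less_imp_le)
    then show False
      using \<open>H r = H s\<close> by simp
  qed
  have nonzero: "A $ r \<noteq> 0" for r
  proof
    assume "A $ r = 0"
    then have "(A *v x) $ r = 0" for x
      by (simp only: row inner_zero_left)
    then show False
      using inner[of r] irredundant[of r] by force
  qed
  have "open (\<Inter>r. {x. A $ r \<bullet> x < b $ r})"
    by (intro open_INT) (auto intro: open_halfspace_lt)
  moreover have "(\<Inter>r. {x. A $ r \<bullet> x < b $ r}) \<subseteq> feasible A b"
    unfolding feasible_eq_INT by (fast intro: less_imp_le)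
  ultimately have "(\<Inter>r. {x. A $ r \<bullet> x < b $ r}) \<subseteq> interior (feasible A b)"
    by (intro interior_maximal)
  moreover have "w \<in> (\<Inter>r. {x. A $ r \<bullet> x < b $ r})"
    using inner unfolding row by blast
  ultimately have "interior (feasible A b) \<noteq> {}"
    by blast
  then have aff: "affine hull (feasible A b) = UNIV"
    by (rule affine_hull_nonempty_interior)
  \<comment> \<open>The rule \<open>facet_of_polyhedron_explicit\<close> indexes normal vectors by
    halfspaces; since \<open>H\<close> is injective, \<open>inv H\<close> recovers the row from its
    halfspace.\<close>
  have "F facet_of feasible A b \<longleftrightarrow>
     (\<exists>h. h \<in> range H \<and> F = feasible A b \<inter> {x. A $ (inv H h) \<bullet> x = b $ (inv H h)})" for F
  proof (rule facet_of_polyhedron_explicit)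
    show "finite (range H)"
      by simp
    show "feasible A b = affine hull feasible A b \<inter> \<Inter> (range H)"
      using P aff by simp
    show "A $ inv H h \<noteq> 0 \<and> h = {x. A $ inv H h \<bullet> x \<le> b $ inv H h}" if "h \<in> range H" for h
      using that nonzero inj by (auto simp: H_def[symmetric] f_inv_into_f) (auto simp: H_def)
    show "feasible A b \<subset> affine hull feasible A b \<inter> \<Inter> F'" if F': "F' \<subset> range H" for F'
    proof -
      obtain r where r: "H r \<notin> F'"
        using F' by blast
      obtain z where z: "b $ r < (A *v z) $ r" "\<forall>s. s \<noteq> r \<longrightarrow> (A *v z) $ s < b $ s"
        using irredundant by blast
      have "z \<in> h" if "h \<in> F'" for h
      proof -
        have "h \<in> range H" using that F' by (meson psubsetD)
        then obtain s where "h = H s" by blast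
        then show ?thesis
          using z(2) r that by (cases "s = r") (auto simp: H_def row less_imp_le)
      qed
      moreover have "z \<notin> feasible A b"
        using z(1) by (auto simp: feasible_def not_le)
      moreover have "feasible A b \<subseteq> \<Inter> F'"
        unfolding P using F' by (intro Inter_anti_mono) (rule psubset_imp_subset)
      ultimately show ?thesis
        unfolding aff Int_UNIV_left by blast
    qed
  qed
  then have facets: "{F. F facet_of feasible A b} =
      range (\<lambda>r. feasible A b \<inter> {x. A $ r \<bullet> x = b $ r})"
    using inj by (auto simp: image_iff)
  have "inj (\<lambda>r. feasible A b \<inter> {x. A $ r \<bullet> x = b $ r})"
  proof (rule injI, rule ccontr)
    fix r s
    assume eq: "feasible A b \<inter> {x. A $ r \<bullet> x = b $ r} = feasible A b \<inter> {x. A $ s \<bullet> x = b $ s}"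
      and "r \<noteq> s"
    obtain z where z: "b $ r < (A *v z) $ r" "\<forall>s. s \<noteq> r \<longrightarrow> (A *v z) $ s < b $ s"
      using irredundant by blast
    \<comment> \<open>The segment from \<open>w\<close> to \<open>z\<close> crosses the hyperplane
      of row \<open>r\<close> at parameter \<open>t\<close>, while all other rows are strict at both
      ends. So the crossing point lies on the facet of \<open>r\<close> and on no other.\<close>
    define t where "t = (b $ r - A $ r \<bullet> w) / (A $ r \<bullet> z - A $ r \<bullet> w)"
    have wr: "A $ r \<bullet> w < b $ r" "b $ r < A $ r \<bullet> z"
      using inner[of r] z(1) by (auto simp: row)
    then have t: "0 < t" "t < 1" and teq: "t * (A $ r \<bullet> z - A $ r \<bullet> w) = b $ r - A $ r \<bullet> w"
      by (auto simp: t_def field_simps)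
    define v where "v = w + t *\<^sub>R (z - w)"
    have v: "A $ k \<bullet> v = (1 - t) * (A $ k \<bullet> w) + t * (A $ k \<bullet> z)" for k
      by (simp add: v_def inner_add_right inner_diff_right algebra_simps)
    have vr: "A $ r \<bullet> v = b $ r"
      using teq by (simp add: v algebra_simps)
    have vk: "A $ k \<bullet> v < b $ k" if "k \<noteq> r" for k
    proof -
      have "A $ k \<bullet> v < (1 - t) * b $ k + t * b $ k"
        unfolding v using inner[of k] z(2) that t
        by (intro add_strict_mono mult_strict_left_mono) (auto simp: row)
      then show ?thesis
        by (simp add: algebra_simps)
    qed
    have "A $ k \<bullet> v \<le> b $ k" for k
      using vr vk[of k] by (cases "k = r") simp_all
    then have "v \<in> feasible A b"
      by (simp add: feasible_eq_INT)
    then have "v \<in> feasible A b \<inter> {x. A $ s \<bullet> x = b $ s}"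
      using vr unfolding eq[symmetric] by simp
    then show False
      using vk[of s] \<open>r \<noteq> s\<close> by simp
  qed
  then show ?thesis
    unfolding facets by (simp add: card_image)
qed

section \<open>The Klee-Minty cube and its facets\<close>

text \<open>The index types are arbitrary finite types, so \<open>pos\<close> numbers the
  coordinates, and \<open>lvl\<close> and \<open>up\<close> name the two constraints of each level.
  The assumptions \<open>gap_first\<close> and \<open>gap_top\<close> bound the gain of the two
  kinds of edges that keep the method going: those of level 1, and those whose preceding coordinate
  is 1.\<close>

locale klee_minty =
  fixes pos :: "'n::finite \<Rightarrow> nat" and lvl :: "'m::finite \<Rightarrow> nat" and up :: "'m \<Rightarrow> bool"
    and n :: nat and \<epsilon> c :: real
  assumes pos: "bij_betw pos UNIV {1..n}"
    and lvl_up: "bij_betw (\<lambda>r. (lvl r, up r)) UNIV ({1..n} \<times> UNIV)"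
    and n_pos: "0 < n"
    and eps_pos: "0 < \<epsilon>" and eps_half: "2 * \<epsilon> < 1"
    and gap_first: "\<epsilon> ^ (n - 1) < c" and gap_top: "1 - 2 * \<epsilon> < c"
begin

text \<open>Summing over the preimage of \<open>i\<close> extends the coordinates by 0 outside
  \<open>{1..n}\<close>, which supplies x_0 = 0.\<close>

definition coord :: "real^'n \<Rightarrow> nat \<Rightarrow> real" where
  "coord x i = (\<Sum>j | pos j = i. x $ j)"

definition of_coords :: "(nat \<Rightarrow> real) \<Rightarrow> real^'n" where
  "of_coords u = (\<chi> j. u (pos j))"

definition cube_matrix :: "real^'n^'m" where
  "cube_matrix = (\<chi> r j. (if pos j = lvl r then if up r then 1 else - 1 else 0) +
     (if Suc (pos j) = lvl r then \<epsilon> else 0))"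

definition cube_bound :: "real^'m" where
  "cube_bound = (\<chi> r. if up r then 1 else 0)"

abbreviation "cube \<equiv> feasible cube_matrix cube_bound"

lemma c_pos: "0 < c"
  using gap_top eps_half by linarith

lemma pos_bounds: "1 \<le> pos j" "pos j \<le> n"
  using bij_betw_apply[OF pos, of j] by auto

lemma lvl_bounds: "1 \<le> lvl r" "lvl r \<le> n"
  using bij_betw_apply[OF lvl_up, of r] by auto

lemma pos_eq_iff: "pos i = pos j \<longleftrightarrow> i = j"
  using pos by (auto simp: bij_betw_def inj_def)

lemma obtain_pos:
  assumes "i \<in> {1..n}"
  obtains j where "pos j = i"
  using assms pos by (metis bij_betw_iff_bijections)

lemma obtain_row:
  assumes "i \<in> {1..n}"
  obtains r where "lvl r = i" "up r = s"
proof -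
  have "(i, s) \<in> (\<lambda>r. (lvl r, up r)) ` UNIV"
    using assms lvl_up by (auto simp: bij_betw_def)
  then show ?thesis
    using that by blast
qed

lemma row_eqI: "lvl r = lvl s \<Longrightarrow> up r = up s \<Longrightarrow> r = s"
  using lvl_up by (auto simp: bij_betw_def inj_def)

lemma coord_0 [simp]: "coord x 0 = 0"
proof -
  have "{j. pos j = 0} = {}"
    using pos_bounds(1) by (auto simp: Suc_le_eq)
  then show ?thesis
    unfolding coord_def by (simp only: sum.empty)
qed

lemma coord_pos: "coord x (pos j) = x $ j"
proof -
  have "{i. pos i = pos j} = {j}"
    by (auto simp: pos_eq_iff)
  then show ?thesis
    by (simp add: coord_def)
qed

lemma coord_of_coords: "i \<in> {1..n} \<Longrightarrow> coord (of_coords u) i = u i"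
  by (metis coord_pos obtain_pos of_coords_def vec_lambda_beta)

lemma coord_add: "coord (x + y) i = coord x i + coord y i"
  by (simp add: coord_def sum.distrib)

lemma coord_scaleR: "coord (t *\<^sub>R x) i = t * coord x i"
  by (simp add: coord_def sum_distrib_left)

lemma cube_row:
  "(cube_matrix *v x) $ r = (if up r then 1 else - 1) * coord x (lvl r) + \<epsilon> * coord x (lvl r - 1)"
proof -
  have *: "Suc (pos j) = lvl r \<longleftrightarrow> pos j = lvl r - 1" for j
    using lvl_bounds[of r] by auto
  let ?s = "if up r then 1 else - 1 :: real"
  have "(cube_matrix *v x) $ r =
      (\<Sum>j\<in>UNIV. (if pos j = lvl r then ?s * x $ j else 0) + (if pos j = lvl r - 1 then \<epsilon> * x $ j else 0))"
    unfolding matrix_vector_mult_def cube_matrix_def vec_lambda_beta *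
    by (rule sum.cong) (simp_all add: distrib_right)
  also have "\<dots> = (\<Sum>j | pos j = lvl r. ?s * x $ j) +
      (\<Sum>j | pos j = lvl r - 1. \<epsilon> * x $ j)"
    by (simp only: sum.distrib sum.If_cases finite_UNIV finite) simp
  finally show ?thesis
    by (simp only: coord_def sum_distrib_left)
qed

lemma row_le_iff:
  "(cube_matrix *v x) $ r \<le> cube_bound $ r \<longleftrightarrow>
    (if up r then coord x (lvl r) \<le> 1 - \<epsilon> * coord x (lvl r - 1)
     else \<epsilon> * coord x (lvl r - 1) \<le> coord x (lvl r))"
  by (auto simp: cube_row cube_bound_def)

lemma row_less_iff:
  "(cube_matrix *v x) $ r < cube_bound $ r \<longleftrightarrow>
    (if up r then coord x (lvl r) < 1 - \<epsilon> * coord x (lvl r - 1)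
     else \<epsilon> * coord x (lvl r - 1) < coord x (lvl r))"
  by (auto simp: cube_row cube_bound_def)

lemma row_eq_iff:
  "(cube_matrix *v x) $ r = cube_bound $ r \<longleftrightarrow>
    (if up r then coord x (lvl r) = 1 - \<epsilon> * coord x (lvl r - 1)
     else \<epsilon> * coord x (lvl r - 1) = coord x (lvl r))"
  by (auto simp: cube_row cube_bound_def)

lemma mem_cube_iff:
  "x \<in> cube \<longleftrightarrow> (\<forall>i\<in>{1..n}. \<epsilon> * coord x (i - 1) \<le> coord x i \<and> coord x i \<le> 1 - \<epsilon> * coord x (i - 1))"
  (is "_ \<longleftrightarrow> ?R")
proof
  assume x: "x \<in> cube"
  show ?R
  proof
    fix i assume i: "i \<in> {1..n}"
    obtain r where r: "lvl r = i" "up r = True" using obtain_row[OF i] .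
    obtain s where s: "lvl s = i" "up s = False" using obtain_row[OF i] .
    have "(cube_matrix *v x) $ k \<le> cube_bound $ k" for k
      using x by (simp add: feasible_def)
    from this[of r] this[of s] r s
    show "\<epsilon> * coord x (i - 1) \<le> coord x i \<and> coord x i \<le> 1 - \<epsilon> * coord x (i - 1)"
      by (auto simp: row_le_iff)
  qed
next
  assume ?R
  then show "x \<in> cube"
    using lvl_bounds by (auto simp: feasible_def row_le_iff)
qed

lemma cube_coord_bounds:
  assumes "x \<in> cube" "i \<le> n"
  shows "0 \<le> coord x i" "coord x i \<le> 1"
proof -
  have "0 \<le> coord x i \<and> coord x i \<le> 1"
    using assms(2)
  proof (induction i)
    case (Suc i)
    have i: "Suc i \<in> {1..n}"
      using Suc by simp
    have "\<epsilon> * coord x i \<le> coord x (Suc i) \<and> coord x (Suc i) \<le> 1 - \<epsilon> * coord x i"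
      using bspec[OF assms(1)[unfolded mem_cube_iff] i] by simp
    moreover have "0 \<le> \<epsilon> * coord x i"
      using Suc eps_pos by simp
    ultimately show ?case
      by linarith
  qed simp
  then show "0 \<le> coord x i" "coord x i \<le> 1"
    by auto
qed

lemma cube_component_bounds:
  assumes "x \<in> cube"
  shows "0 \<le> x $ j" "x $ j \<le> 1"
  using cube_coord_bounds[OF assms pos_bounds(2)[of j]] by (simp_all only: coord_pos)

lemma polytope_cube: "polytope cube"
proof -
  have "cube \<subseteq> cbox 0 1"
  proof
    fix x assume "x \<in> cube"
    note bounds = cube_component_bounds[OF this]
    show "x \<in> cbox 0 1"
      unfolding mem_box_cart by (intro allI conjI) (simp_all only: bounds zero_index one_index)
  qed
  then have "bounded cube"
    using bounded_cbox bounded_subset by blast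
  then show ?thesis
    by (simp add: polytope_eq_bounded_polyhedron polyhedron_feasible)
qed

text \<open>All components are nonnegative on the cube, so a proper convex combination of two of its
  points vanishes only if both points do.\<close>

lemma extreme_point_zero: "0 extreme_point_of cube"
proof -
  have z: "coord 0 i = 0" for i
    by (simp add: coord_def)
  have "0 \<notin> open_segment a b" if "a \<in> cube" "b \<in> cube" for a b
  proof
    assume "0 \<in> open_segment a b"
    then obtain u where ab: "a \<noteq> b" and u: "0 < u" "u < 1" "0 = (1 - u) *\<^sub>R a + u *\<^sub>R b"
      by (auto simp: in_segment)
    have "a $ j = 0 \<and> b $ j = 0" for j
    proof -
      have nonneg: "0 \<le> a $ j" "0 \<le> b $ j"
        using that cube_component_bounds by blast+
      have "0 = ((1 - u) *\<^sub>R a + u *\<^sub>R b) $ j"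
        using u(3) by simp
      then have "0 = (1 - u) * a $ j + u * b $ j"
        by simp
      moreover have "0 \<le> (1 - u) * a $ j" "0 \<le> u * b $ j"
        using nonneg u by simp_all
      ultimately have "(1 - u) * a $ j = 0" "u * b $ j = 0"
        by linarith+
      then show ?thesis
        using u by simp
    qed
    then show False
      using ab by (simp add: vec_eq_iff)
  qed
  moreover have "0 \<in> cube"
    by (simp add: mem_cube_iff z)
  ultimately show ?thesis
    by (simp add: extreme_point_of_def)
qed

lemma card_facets_cube: "card {F. F facet_of cube} = CARD('m)"
proof (rule card_facets_feasible[where w = "of_coords (\<lambda>_. 1/2)"])
  have half: "coord (of_coords (\<lambda>_. 1/2)) i = (if i = 0 then 0 else 1/2)" if "i \<le> n" for i
    using that by (auto simp: coord_of_coords)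
  show "(cube_matrix *v of_coords (\<lambda>_. 1/2)) $ r < cube_bound $ r" for r
    using lvl_bounds[of r] eps_half by (auto simp: row_less_iff half)
  show "\<exists>z. cube_bound $ r < (cube_matrix *v z) $ r \<and>
      (\<forall>s. s \<noteq> r \<longrightarrow> (cube_matrix *v z) $ s < cube_bound $ s)" for r
  proof -
    \<comment> \<open>The number \<open>p\<close> is the coordinate that enters the bounds of level
      \<open>lvl r\<close>; at level 1 it is x_0 = 0. The value \<open>t\<close> oversteps the bound
      of row \<open>r\<close> by 1/2 - \<epsilon>.\<close>
    define p :: real where "p = (if lvl r = 1 then 0 else 1/2)"
    define t where "t = (if up r then 3/2 - \<epsilon> - \<epsilon> * p else \<epsilon> * p - (1/2 - \<epsilon>))"
    define z where "z = of_coords (\<lambda>i. if i = lvl r then t else 1/2)"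
    have z: "coord z i = (if i = 0 then 0 else if i = lvl r then t else 1/2)" if "i \<le> n" for i
      using that lvl_bounds[of r] by (auto simp: z_def coord_of_coords)
    have zp: "coord z (lvl r - 1) = p" and zl: "coord z (lvl r) = t"
      using lvl_bounds[of r] by (auto simp: z p_def)
    have ep: "0 \<le> \<epsilon> * p" "\<epsilon> * p \<le> \<epsilon> / 2"
      using eps_pos by (auto simp: p_def)
    \<comment> \<open>The overstep must not violate the next level. There the coordinate is 1/2, so
      both rows stay strict as long as \<open>\<epsilon> * t\<close> is less than 1/2.\<close>
    have "(1 - 2 * \<epsilon>) * (1 - \<epsilon>) > 0"
      using eps_half eps_pos by simp
    then have "\<epsilon> * (3/2 - \<epsilon>) < 1/2"
      by (simp add: algebra_simps)
    moreover have "t \<le> 3/2 - \<epsilon>"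
      using ep eps_pos eps_half unfolding t_def by (cases "up r"; simp only: if_True if_False; linarith)
    then have "\<epsilon> * t \<le> \<epsilon> * (3/2 - \<epsilon>)"
      using eps_pos by simp
    ultimately have et: "\<epsilon> * t < 1/2"
      by linarith
    have "(cube_matrix *v z) $ s < cube_bound $ s" if "s \<noteq> r" for s
    proof (cases "lvl s = lvl r")
      case True
      then have up_s: "up s = (\<not> up r)"
        using row_eqI that by blast
      show ?thesis
        using ep eps_half eps_pos unfolding row_less_iff True up_s zp zl t_def
        by (cases "up r"; simp only: if_True if_False simp_thms; linarith)
    next
      case False
      then have "coord z (lvl s) = 1/2"
        using lvl_bounds[of s] by (simp add: z)
      moreover have "coord z (lvl s - 1) = 0 \<or> coord z (lvl s - 1) = t \<or> coord z (lvl s - 1) = 1/2"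
        using lvl_bounds[of s] by (auto simp: z)
      then have "\<epsilon> * coord z (lvl s - 1) < 1/2"
        using et eps_half by (elim disjE) (erule ssubst, simp)+
      ultimately show ?thesis
        unfolding row_less_iff by (cases "up s"; simp only: if_True if_False; linarith)
    qed
    moreover have "\<not> (cube_matrix *v z) $ r \<le> cube_bound $ r"
      using eps_half unfolding row_le_iff zp zl t_def
      by (cases "up r"; simp only: if_True if_False; linarith)
    ultimately show ?thesis
      by (auto simp: not_le)
  qed
qed

section \<open>The objective function\<close>

primrec lift :: "real^'n \<Rightarrow> nat \<Rightarrow> real" where
  "lift x 0 = 0"
| "lift x (Suc i) = coord x (Suc i) - \<epsilon> * coord x i + \<epsilon>\<^sup>2 * lift x i"

definition objective :: "real^'n \<Rightarrow> real" where
  "objective x = (coord x n)\<^sup>2 + c * coord x n - lift x n"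

lemma lift_add: "lift (x + y) i = lift x i + lift y i"
  by (induction i) (simp_all add: coord_add algebra_simps)

lemma lift_scaleR: "lift (t *\<^sub>R x) i = t * lift x i"
  by (induction i) (simp_all add: coord_scaleR algebra_simps)

text \<open>Linear forms are inner products with fixed vectors. This turns \<open>objective\<close>
  into a square of one inner product plus another, from which its matrix, here of rank one, and its
  gradient can be read off.\<close>

lemma obtain_normal_vectors:
  obtains p q where "\<And>x. coord x n = p \<bullet> x" "\<And>x. c * coord x n - lift x n = q \<bullet> x"
proof
  have 1: "linear (\<lambda>x. coord x n)"
    by (rule linearI) (simp_all add: coord_add coord_scaleR)
  show "coord x n = adjoint (\<lambda>x. coord x n) 1 \<bullet> x" for x
    using adjoint_works[OF 1, of x 1] by (simp add: inner_commute)
  have 2: "linear (\<lambda>x. c * coord x n - lift x n)"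
    by (rule linearI) (simp_all add: coord_add coord_scaleR lift_add lift_scaleR algebra_simps)
  show "c * coord x n - lift x n = adjoint (\<lambda>x. c * coord x n - lift x n) 1 \<bullet> x" for x
    using adjoint_works[OF 2, of x 1] by (simp add: inner_commute)
qed

lemma quadratic_polynomial_objective: "quadratic_polynomial objective"
proof -
  obtain p q where p: "\<And>x. coord x n = p \<bullet> x" and q: "\<And>x. c * coord x n - lift x n = q \<bullet> x"
    using obtain_normal_vectors by blast
  define Q :: "real^'n^'n" where "Q = (\<chi> i j. p $ i * p $ j)"
  have Q: "Q *v x = (p \<bullet> x) *\<^sub>R p" for x
    by (simp add: Q_def vec_eq_iff matrix_vector_mult_def inner_vec_def sum_distrib_left mult_ac)
  have "transpose Q = Q"
    by (simp add: Q_def transpose_def vec_eq_iff mult.commute)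
  moreover have "Q \<noteq> 0"
  proof
    assume "Q = 0"
    obtain j where j: "pos j = n"
      using obtain_pos[of n] n_pos by auto
    have "p \<bullet> axis j 1 = 1"
      using p[of "axis j 1"] coord_pos[of "axis j 1" j] j by simp
    then have "p = 0"
      using Q[of "axis j 1"] \<open>Q = 0\<close> by simp
    then show False
      using \<open>p \<bullet> axis j 1 = 1\<close> by simp
  qed
  moreover have "objective = (\<lambda>x. x \<bullet> (Q *v x) + q \<bullet> x + 0)"
  proof
    fix x
    have "objective x = (p \<bullet> x)\<^sup>2 + q \<bullet> x"
      unfolding objective_def q[symmetric] p[symmetric] by simp
    then show "objective x = x \<bullet> (Q *v x) + q \<bullet> x + 0"
      by (simp add: Q power2_eq_square inner_commute)
  qed
  ultimately show ?thesis
    unfolding quadratic_polynomial_def by blast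
qed

lemma gradient_objective:
  "gradient objective x \<bullet> e = (2 * coord x n + c) * coord e n - lift e n"
proof -
  obtain p q where p: "\<And>x. coord x n = p \<bullet> x" and q: "\<And>x. c * coord x n - lift x n = q \<bullet> x"
    using obtain_normal_vectors by blast
  have "objective = (\<lambda>x. (p \<bullet> x)\<^sup>2 + q \<bullet> x)"
    unfolding objective_def q[symmetric] p[symmetric] by (simp add: fun_eq_iff)
  moreover have "GDERIV (\<lambda>x. (p \<bullet> x)\<^sup>2 + q \<bullet> x) x :> (2 * (p \<bullet> x)) *\<^sub>R p + q"
    unfolding gderiv_def
    by (auto intro!: derivative_eq_intros simp: fun_eq_iff inner_add_right inner_commute)
  ultimately have "gradient objective x \<bullet> e = 2 * (p \<bullet> x) * (p \<bullet> e) + q \<bullet> e"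
    by (simp add: gradient_eq inner_add_left)
  then show ?thesis
    unfolding q[symmetric] p[symmetric] by (simp add: algebra_simps)
qed

lemma convex_objective: "convex_on UNIV objective"
proof (rule convex_onI)
  fix t :: real and x y assume t: "0 < t" "t < 1"
  \<comment> \<open>Everything but the square of x_n is linear, so this product is exactly the
    difference of the two sides.\<close>
  have "0 \<le> t * (1 - t) * (coord x n - coord y n)\<^sup>2"
    using t by simp
  then show "objective ((1 - t) *\<^sub>R x + t *\<^sub>R y) \<le> (1 - t) * objective x + t * objective y"
    unfolding objective_def coord_add coord_scaleR lift_add lift_scaleR
    by (simp add: power2_eq_square algebra_simps)
qed simp

text \<open>With a and b the coordinates \<open>i\<close> and \<open>Suc i\<close>, the difference
  of \<open>lift x (Suc i)\<close> and b^2 equals (b - \<epsilon> a)(1 - \<epsilon> a - b) plus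
  \<epsilon>^2 times the difference of \<open>lift x i\<close> and a^2. On the cube both factors are
  nonnegative, so the square never exceeds the lift.\<close>

lemma objective_le:
  assumes "x \<in> cube"
  shows "objective x \<le> c"
proof -
  have "(coord x i)\<^sup>2 \<le> lift x i" if "i \<le> n" for i
    using that
  proof (induction i)
    case (Suc i)
    let ?a = "coord x i" and ?b = "coord x (Suc i)"
    have "\<epsilon> * ?a \<le> ?b" "?b \<le> 1 - \<epsilon> * ?a"
      using Suc.prems bspec[OF assms[unfolded mem_cube_iff], of "Suc i"] by auto
    then have "0 \<le> (?b - \<epsilon> * ?a) * (1 - \<epsilon> * ?a - ?b)"
      by simp
    moreover have "\<epsilon>\<^sup>2 * ?a\<^sup>2 \<le> \<epsilon>\<^sup>2 * lift x i"
      using Suc by (intro mult_left_mono) auto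
    ultimately show ?case
      by (simp add: power2_eq_square algebra_simps)
  qed simp
  from this[of n] have "objective x \<le> c * coord x n"
    by (simp add: objective_def)
  also have "\<dots> \<le> c"
    using cube_coord_bounds[OF assms, of n] c_pos by simp
  finally show ?thesis .
qed

section \<open>Vertices, and the slope of the objective in terms of slacks\<close>

text \<open>The set \<open>S\<close> records the levels whose upper constraint is tight; the
  equations then determine the coordinates one level after another.\<close>

definition vertex :: "real^'n \<Rightarrow> nat set \<Rightarrow> bool" where
  "vertex x S \<longleftrightarrow> (\<forall>i\<in>{1..n}. coord x i =
     (if i \<in> S then 1 - \<epsilon> * coord x (i - 1) else \<epsilon> * coord x (i - 1)))"

definition tight_rows :: "nat set \<Rightarrow> 'm set" where
  "tight_rows S = {r. up r \<longleftrightarrow> lvl r \<in> S}"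

definition sig :: "nat set \<Rightarrow> nat \<Rightarrow> real" where
  "sig S i = (if i \<in> S then - 1 else 1)"

text \<open>The rate at which moving along \<open>e\<close> loosens the constraint of level \<open>i\<close> that is tight at the
  vertex \<open>S\<close>. The slacks determine \<open>e\<close>, and the edge of level \<open>i\<close> has exactly one nonzero slack.\<close>

definition slack :: "nat set \<Rightarrow> real^'n \<Rightarrow> nat \<Rightarrow> real" where
  "slack S e i = sig S i * coord e i - \<epsilon> * coord e (i - 1)"

text \<open>The sign with which a slack of level \<open>i\<close> acts on coordinate
  \<open>m\<close>: every level from \<open>i\<close> to \<open>m\<close> that is at its upper bound
  reverses it once.\<close>

definition orient :: "nat set \<Rightarrow> nat \<Rightarrow> nat \<Rightarrow> real" where
  "orient S m i = (\<Prod>j=i..m. sig S j)"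

text \<open>The edge of level \<open>i\<close> changes the last coordinate by \<open>orient S n i * gap x i\<close>.\<close>

definition gap :: "real^'n \<Rightarrow> nat \<Rightarrow> real" where
  "gap x i = \<epsilon> ^ (n - i) * (1 - 2 * \<epsilon> * coord x (i - 1))"

text \<open>Positivity of the coefficient of level \<open>i\<close> in \<open>slope_vertex\<close>.
  As gaps are positive and \<open>orient\<close> is 1 or -1, it says both that the edge raises x_n
  and that it does so by less than \<open>c\<close>.\<close>

definition improving :: "real^'n \<Rightarrow> nat set \<Rightarrow> nat \<Rightarrow> bool" where
  "improving x S i \<longleftrightarrow> i \<in> {1..n} \<and> gap x i < c * orient S n i"

lemma vertex_Suc:
  assumes "vertex x S" "Suc i \<le> n"
  shows "coord x (Suc i) = (if Suc i \<in> S then 1 - \<epsilon> * coord x i else \<epsilon> * coord x i)"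
  using assms unfolding vertex_def by force

lemma vertex_mem_cube:
  assumes "vertex x S"
  shows "x \<in> cube"
proof -
  have bounds: "0 \<le> coord x i \<and> coord x i \<le> 1" if "i \<le> n" for i
    using that
  proof (induction i)
    case (Suc i)
    then have "0 \<le> \<epsilon> * coord x i" "\<epsilon> * coord x i \<le> \<epsilon> * 1"
      using eps_pos by (auto intro: mult_left_mono simp del: mult_1_right)
    then show ?case
      using vertex_Suc[OF assms Suc.prems] eps_half by auto
  qed simp
  show ?thesis
    unfolding mem_cube_iff
  proof
    fix i assume i: "i \<in> {1..n}"
    then have "0 \<le> \<epsilon> * coord x (i - 1)" "\<epsilon> * coord x (i - 1) \<le> \<epsilon> * 1"
      using eps_pos bounds[of "i - 1"] by (auto intro: mult_left_mono simp del: mult_1_right)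
    then show "\<epsilon> * coord x (i - 1) \<le> coord x i \<and> coord x i \<le> 1 - \<epsilon> * coord x (i - 1)"
      using assms i eps_half unfolding vertex_def by auto
  qed
qed

lemma vertex_bounds:
  assumes "vertex x S" "i \<le> n"
  shows "0 \<le> coord x i" "coord x i \<le> 1"
  using cube_coord_bounds[OF vertex_mem_cube[OF assms(1)] assms(2)] .

lemma eps_coord_less:
  assumes "vertex x S" "i \<le> n"
  shows "\<epsilon> * coord x i < 1 - \<epsilon> * coord x i"
proof -
  have "\<epsilon> * coord x i \<le> \<epsilon> * 1"
    using vertex_bounds[OF assms] eps_pos by (intro mult_left_mono) auto
  then show ?thesis
    using eps_half by linarith
qed

text \<open>The two bounds of a level never meet, because \<epsilon> is less than 1/2. Hence exactly
  one row per level is tight, and vertices are nondegenerate.\<close>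

lemma tight_vertex:
  assumes "vertex x S"
  shows "tight cube_matrix cube_bound x = tight_rows S"
proof -
  have "r \<in> tight cube_matrix cube_bound x \<longleftrightarrow> r \<in> tight_rows S" for r
  proof -
    have l: "lvl r \<in> {1..n}" "lvl r - 1 \<le> n"
      using lvl_bounds[of r] by auto
    then have "coord x (lvl r) =
        (if lvl r \<in> S then 1 - \<epsilon> * coord x (lvl r - 1) else \<epsilon> * coord x (lvl r - 1))"
      using assms unfolding vertex_def by blast
    then show ?thesis
      using eps_coord_less[OF assms l(2)]
      unfolding tight_def tight_rows_def mem_Collect_eq row_eq_iff by (cases "lvl r \<in> S"; cases "up r") auto
  qed
  then show ?thesis
    by blast
qed

text \<open>At a vertex one of the two slack factors vanishes at each level, so the inequality
  between square and lift behind \<open>objective_le\<close> becomes an equality.\<close>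

lemma objective_vertex:
  assumes "vertex x S"
  shows "objective x = c * coord x n"
proof -
  have "lift x i = (coord x i)\<^sup>2" if "i \<le> n" for i
    using that
  proof (induction i)
    case (Suc i)
    then show ?case
      using vertex_Suc[OF assms Suc.prems] by (auto simp: power2_eq_square algebra_simps)
  qed simp
  then show ?thesis
    by (simp add: objective_def)
qed

lemma row_direction:
  assumes "r \<in> tight_rows S"
  shows "(cube_matrix *v e) $ r = - slack S e (lvl r)"
  using assms by (simp add: cube_row slack_def tight_rows_def sig_def)

lemma sig_mult_self [simp]: "sig S i * sig S i = 1"
  by (simp add: sig_def)

lemma coord_eq_slack: "coord e i = sig S i * (\<epsilon> * coord e (i - 1) + slack S e i)"
  by (simp add: slack_def sig_def)

lemma orient_Suc: "i \<le> Suc m \<Longrightarrow> orient S (Suc m) i = orient S m i * sig S (Suc m)"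
  by (simp add: orient_def prod.nat_ivl_Suc' mult.commute)

lemma orient_Suc_self [simp]: "orient S m (Suc m) = 1"
  by (simp add: orient_def)

lemma abs_orient: "\<bar>orient S m i\<bar> = 1"
  unfolding orient_def abs_prod by (rule prod.neutral) (simp add: sig_def)

text \<open>Unrolls the recursion \<open>coord_eq_slack\<close>: on its way up to level
  \<open>m\<close>, a slack picks up a factor \<epsilon> per level climbed and a sign at every
  level.\<close>

lemma coord_eq_sum:
  "coord e m = (\<Sum>i=1..m. orient S m i * \<epsilon> ^ (m - i) * slack S e i)"
proof (induction m)
  case (Suc m)
  have "(\<Sum>i=1..Suc m. orient S (Suc m) i * \<epsilon> ^ (Suc m - i) * slack S e i) =
      (\<Sum>i=1..m. sig S (Suc m) * \<epsilon> * (orient S m i * \<epsilon> ^ (m - i) * slack S e i)) +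
      sig S (Suc m) * slack S e (Suc m)"
    by (simp add: orient_Suc Suc_diff_le mult_ac)
  also have "\<dots> = sig S (Suc m) * (\<epsilon> * coord e m + slack S e (Suc m))"
    unfolding sum_distrib_left[symmetric] Suc.IH[symmetric] by (simp add: algebra_simps)
  also have "\<dots> = coord e (Suc m)"
    using coord_eq_slack[of e "Suc m" S] by simp
  finally show ?case ..
qed simp

text \<open>The derivative at the vertex of the square minus the lift. That function is at most 0 on
  the cube and 0 at the vertex, which is why all coefficients of the slacks are negative. The factor
  \<epsilon>^2 in the recursion of \<open>lift\<close> makes the powers of \<epsilon> the squares of
  those in \<open>coord_eq_sum\<close>.\<close>

lemma deriv_square_minus_lift:
  assumes "vertex x S" "m \<le> n"
  shows "2 * coord x m * coord e m - lift e m =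
    - (\<Sum>i=1..m. (\<epsilon> ^ (m - i))\<^sup>2 * (1 - 2 * \<epsilon> * coord x (i - 1)) * slack S e i)"
  using assms(2)
proof (induction m)
  case (Suc m)
  let ?t = "\<lambda>m i. (\<epsilon> ^ (m - i))\<^sup>2 * (1 - 2 * \<epsilon> * coord x (i - 1)) * slack S e i"
  \<comment> \<open>Here the vertex equation enters: up to sign, this is the distance between the
    two bounds of the level.\<close>
  have x: "2 * coord x (Suc m) - 1 = - sig S (Suc m) * (1 - 2 * \<epsilon> * coord x m)"
    using vertex_Suc[OF assms(1) Suc.prems] by (simp add: sig_def)
  have "(\<Sum>i=1..Suc m. ?t (Suc m) i) =
      (\<Sum>i=1..m. \<epsilon>\<^sup>2 * ?t m i) + (1 - 2 * \<epsilon> * coord x m) * slack S e (Suc m)"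
    by (simp add: Suc_diff_le power_mult_distrib mult.assoc)
  also have "\<dots> = - \<epsilon>\<^sup>2 * (2 * coord x m * coord e m - lift e m) +
      (1 - 2 * \<epsilon> * coord x m) * slack S e (Suc m)"
    unfolding sum_distrib_left[symmetric] using Suc by simp
  also have "\<dots> = - (2 * coord x (Suc m) * coord e (Suc m) - lift e (Suc m))"
  proof -
    have "2 * coord x (Suc m) * coord e (Suc m) =
        coord e (Suc m) - sig S (Suc m) * coord e (Suc m) * (1 - 2 * \<epsilon> * coord x m)"
      using arg_cong[OF x, of "\<lambda>v. v * coord e (Suc m)"] by (simp add: algebra_simps)
    moreover have "sig S (Suc m) * coord e (Suc m) = slack S e (Suc m) + \<epsilon> * coord e m"
      by (simp add: slack_def)
    ultimately show ?thesis
      by (simp add: power2_eq_square algebra_simps)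
  qed
  finally show ?case
    by simp
qed simp

text \<open>The slope separates into one term per level, so whether an edge is improving depends on
  the coefficient of its level alone.\<close>

lemma slope_vertex:
  assumes "vertex x S"
  shows "gradient objective x \<bullet> e =
    (\<Sum>i=1..n. \<epsilon> ^ (n - i) * slack S e i * (c * orient S n i - gap x i))"
proof -
  have "gradient objective x \<bullet> e = c * coord e n + (2 * coord x n * coord e n - lift e n)"
    by (simp add: gradient_objective algebra_simps)
  also have "\<dots> = (\<Sum>i=1..n. c * (orient S n i * \<epsilon> ^ (n - i) * slack S e i)) -
      (\<Sum>i=1..n. (\<epsilon> ^ (n - i))\<^sup>2 * (1 - 2 * \<epsilon> * coord x (i - 1)) * slack S e i)"
    unfolding deriv_square_minus_lift[OF assms order_refl] by (simp add: coord_eq_sum[of e n S] sum_distrib_left)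
  also have "\<dots> = (\<Sum>i=1..n. \<epsilon> ^ (n - i) * slack S e i * (c * orient S n i - gap x i))"
    unfolding sum_subtractf[symmetric]
    by (rule sum.cong) (simp_all add: gap_def power2_eq_square algebra_simps)
  finally show ?thesis .
qed

section \<open>Improving directions and improving edges\<close>

abbreviation "directions x \<equiv> improving_directions objective cube_matrix cube_bound x"

text \<open>The second bound depends on neither the vertex nor the level; it is the least gain of a
  move and serves for termination.\<close>

lemma gap_bounds:
  assumes "vertex x S" "i \<in> {1..n}"
  shows "0 < gap x i" "\<epsilon> ^ n * (1 - 2 * \<epsilon>) \<le> gap x i"
proof -
  have less: "\<epsilon> * coord x (i - 1) < 1 - \<epsilon> * coord x (i - 1)"
    using assms by (intro eps_coord_less) auto
  then show "0 < gap x i"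
    using eps_pos by (simp add: gap_def)
  have "\<epsilon> ^ n \<le> \<epsilon> ^ (n - i)"
    using eps_pos eps_half by (intro power_decreasing) auto
  moreover have "\<epsilon> * coord x (i - 1) \<le> \<epsilon> * 1"
    using assms eps_pos vertex_bounds[of x S "i - 1"] by (intro mult_left_mono) auto
  ultimately show "\<epsilon> ^ n * (1 - 2 * \<epsilon>) \<le> gap x i"
    unfolding gap_def using eps_pos eps_half by (intro mult_mono) auto
qed

lemma improvingD:
  assumes "vertex x S" "improving x S i"
  shows "i \<in> {1..n}" "orient S n i = 1" "gap x i < c"
proof -
  have i: "i \<in> {1..n}" "gap x i < c * orient S n i"
    using assms(2) by (auto simp: improving_def)
  have "0 < gap x i"
    using gap_bounds[OF assms(1) i(1)] by simp
  then have "0 < orient S n i"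
    using i(2) c_pos by (smt (verit) mult_nonneg_nonpos)
  then have "orient S n i = 1"
    using abs_orient[of S n i] by simp
  then show "i \<in> {1..n}" "orient S n i = 1" "gap x i < c"
    using i by simp_all
qed

lemma mem_directions_iff:
  assumes "vertex x S"
  shows "e \<in> directions x \<longleftrightarrow> (\<forall>r\<in>tight_rows S. 0 \<le> slack S e (lvl r)) \<and> 0 < gradient objective x \<bullet> e"
  unfolding improving_directions_def tight_vertex[OF assms] by (auto simp: row_direction)

lemma obtain_row_in_rows:
  assumes "i \<in> {1..n}"
  obtains r where "r \<in> tight_rows S" "lvl r = i"
  using obtain_row[OF assms, of "i \<in> S"] unfolding tight_rows_def by blast

lemma lvl_inj_rows: "r \<in> tight_rows S \<Longrightarrow> s \<in> tight_rows S \<Longrightarrow> lvl r = lvl s \<Longrightarrow> r = s"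
  using row_eqI[of r s] by (auto simp: tight_rows_def)

text \<open>A positive sum has a positive summand. Slacks of a feasible direction are nonnegative,
  so in that summand both the slack and the coefficient of the level are positive.\<close>

lemma direction_slack:
  assumes "vertex x S" "e \<in> directions x"
  obtains r where "r \<in> tight_rows S" "improving x S (lvl r)" "0 < slack S e (lvl r)"
proof -
  have "0 < (\<Sum>i=1..n. \<epsilon> ^ (n - i) * slack S e i * (c * orient S n i - gap x i))"
    using assms mem_directions_iff slope_vertex by simp
  then obtain i where i: "i \<in> {1..n}"
    and pos: "0 < \<epsilon> ^ (n - i) * slack S e i * (c * orient S n i - gap x i)"
    by (meson not_le sum_nonpos)
  obtain r where r: "r \<in> tight_rows S" "lvl r = i"
    using obtain_row_in_rows[OF i] .
  have "0 \<le> slack S e i"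
    using assms mem_directions_iff r by blast
  then have "0 \<le> \<epsilon> ^ (n - i) * slack S e i"
    using eps_pos by simp
  then have "0 < \<epsilon> ^ (n - i) * slack S e i" "0 < c * orient S n i - gap x i"
    using pos by (meson not_le zero_less_mult_iff)+
  moreover from this(1) have "0 < slack S e i"
    using eps_pos by (simp add: zero_less_mult_iff)
  ultimately have "0 < slack S e i" "0 < c * orient S n i - gap x i"
    by simp_all
  then show ?thesis
    using that r i by (auto simp: improving_def)
qed

lemma obtain_edge:
  assumes "vertex x S" "improving x S i"
  obtains e where "e \<in> directions x" "\<And>k. k \<in> {1..n} \<Longrightarrow> slack S e k = (if k = i then 1 else 0)"
proof -
  \<comment> \<open>The solution of the recursion \<open>coord_eq_slack\<close> whose only slack is
    a unit at level \<open>i\<close>.\<close>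
  define u :: "nat \<Rightarrow> real" where
    "u = rec_nat 0 (\<lambda>k v. sig S (Suc k) * (\<epsilon> * v + (if Suc k = i then 1 else 0)))"
  have u: "u 0 = 0" "u (Suc k) = sig S (Suc k) * (\<epsilon> * u k + (if Suc k = i then 1 else 0))" for k
    by (simp_all add: u_def)
  define e where "e = of_coords u"
  have coord: "coord e k = u k" if "k \<le> n" for k
    using that u(1) by (cases "k = 0") (auto simp: e_def coord_of_coords)
  have slack: "slack S e k = (if k = i then 1 else 0)" if k: "k \<in> {1..n}" for k
  proof -
    obtain j where j: "k = Suc j"
      using k by (cases k) auto
    show ?thesis
      using k by (simp add: slack_def j coord u(2) mult.assoc[symmetric] del: of_nat_Suc)
  qed
  have i: "i \<in> {1..n}" "0 < c * orient S n i - gap x i"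
    using assms(2) by (auto simp: improving_def)
  have "gradient objective x \<bullet> e =
      (\<Sum>k=1..n. if k = i then \<epsilon> ^ (n - i) * (c * orient S n i - gap x i) else 0)"
    unfolding slope_vertex[OF assms(1)] by (rule sum.cong) (auto simp: slack)
  also have "\<dots> = \<epsilon> ^ (n - i) * (c * orient S n i - gap x i)"
    using i by simp
  finally have "0 < gradient objective x \<bullet> e"
    using i eps_pos by simp
  then have "e \<in> directions x"
    using lvl_bounds by (auto simp: mem_directions_iff[OF assms(1)] slack)
  then show ?thesis
    using that slack by blast
qed

text \<open>If the edge of level 1 raises x_n, it is improving by \<open>gap_first\<close>.
  Otherwise let \<open>k\<close> be the least level in \<open>S\<close>: then x_k = 1, the edge of
  level \<open>k + 1\<close> raises x_n, and its gain is at most 1 - 2 \<epsilon>, which is less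
  than \<open>c\<close> by \<open>gap_top\<close>.\<close>

lemma directions_nonempty:
  assumes "vertex x S" "coord x n \<noteq> 1"
  shows "directions x \<noteq> {}"
proof -
  have "\<exists>i. improving x S i"
  proof (cases "orient S n 1 = 1")
    case True
    then show ?thesis
      using n_pos gap_first by (intro exI[of _ 1]) (simp add: improving_def gap_def)
  next
    case False
    then have neg: "orient S n 1 = - 1"
      using abs_orient[of S n 1] by linarith
    have "\<exists>k. 1 \<le> k \<and> k \<le> n \<and> k \<in> S"
    proof (rule ccontr)
      assume "\<not> ?thesis"
      then have "orient S n 1 = 1"
        unfolding orient_def by (intro prod.neutral) (auto simp: sig_def)
      then show False
        using False by simp
    qed
    then obtain k where k: "1 \<le> k" "k \<le> n" "k \<in> S"
      and least: "\<And>j. j < k \<Longrightarrow> \<not> (1 \<le> j \<and> j \<le> n \<and> j \<in> S)"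
      using exists_least_iff[of "\<lambda>k. 1 \<le> k \<and> k \<le> n \<and> k \<in> S"] by blast
    have min: "j \<notin> S" if "j < k" "1 \<le> j" for j
      using least[OF that(1)] that k(2) by simp
    obtain k' where k': "k = Suc k'"
      using k by (cases k) auto
    have zero: "coord x j = 0" if "j < k" for j
      using that
    proof (induction j)
      case (Suc j)
      then show ?case
        using vertex_Suc[OF assms(1), of j] min[of "Suc j"] k by auto
    qed simp
    have one: "coord x k = 1"
      using vertex_Suc[OF assms(1), of k'] k k' zero[of k'] by simp
    \<comment> \<open>Only here is x_n \<noteq> 1 used: it guarantees that level
      \<open>k + 1\<close> exists.\<close>
    then have "k < n"
      using assms(2) k by (cases "k = n") auto
    have "orient S k' 1 = 1"
      unfolding orient_def using min k' by (intro prod.neutral) (auto simp: sig_def)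
    then have "orient S k 1 = - 1"
      using k by (simp add: k' orient_Suc sig_def)
    \<comment> \<open>Level \<open>k\<close> accounts for the negative sign on the way from 1 to
      \<open>k\<close>, so the signs above \<open>k\<close> multiply to 1.\<close>
    moreover have "orient S n 1 = orient S k 1 * orient S n (Suc k)"
      unfolding orient_def using k by (subst prod.union_disjoint[symmetric]) (auto intro: prod.cong)
    ultimately have "orient S n (Suc k) = 1"
      using neg by simp
    moreover have "\<epsilon> ^ (n - Suc k) * (1 - 2 * \<epsilon>) \<le> 1 * (1 - 2 * \<epsilon>)"
      using eps_pos eps_half by (intro mult_right_mono power_le_one) auto
    then have "gap x (Suc k) < c"
      using gap_top by (simp add: gap_def one)
    ultimately have "improving x S (Suc k)"
      using \<open>k < n\<close> by (simp add: improving_def)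
    then show ?thesis ..
  qed
  then show ?thesis
    using obtain_edge[OF assms(1)] by (metis empty_iff)
qed

section \<open>Single iterations of the active-set method\<close>

lemma zero_rows:
  "\<A> \<subseteq> tight_rows S \<Longrightarrow> {k \<in> \<A>. (cube_matrix *v e) $ k = 0} = {r \<in> \<A>. slack S e (lvl r) = 0}"
  by (auto simp: row_direction subset_iff)

text \<open>Every improving direction loosens at least one row, and an improving edge loosens
  exactly one. So the maximizers are precisely the improving directions along a single edge.\<close>

lemma arg_max_full:
  assumes x: "vertex x S"
  shows "is_arg_max (\<lambda>e. card {k \<in> tight_rows S. (cube_matrix *v e) $ k = 0}) (\<lambda>e. e \<in> directions x) e \<longleftrightarrow>
    e \<in> directions x \<and> (\<exists>r\<in>tight_rows S. \<forall>s\<in>tight_rows S. slack S e (lvl s) \<noteq> 0 \<longleftrightarrow> s = r)"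
    (is "?L \<longleftrightarrow> ?R")
proof -
  let ?Z = "\<lambda>e. {r \<in> tight_rows S. slack S e (lvl r) = 0}"
  have less: "card (?Z f) < card (tight_rows S)" if "f \<in> directions x" for f
  proof -
    obtain r where "r \<in> tight_rows S" "0 < slack S f (lvl r)"
      using direction_slack[OF x \<open>f \<in> directions x\<close>] by blast
    then have "r \<in> tight_rows S - ?Z f"
      by simp
    then have "?Z f \<subset> tight_rows S"
      by blast
    then show ?thesis
      by (intro psubset_card_mono finite)
  qed
  have single: "card (?Z f) = card (tight_rows S) - 1"
    if "r \<in> tight_rows S" "\<forall>s\<in>tight_rows S. slack S f (lvl s) \<noteq> 0 \<longleftrightarrow> s = r" for f r
  proof -
    have "?Z f = tight_rows S - {r}"
      using that by auto
    then show ?thesis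
      using that by simp
  qed
  show ?thesis
    unfolding is_arg_max_def zero_rows[OF order_refl]
  proof (intro conj_cong iffI refl)
    assume e: "e \<in> directions x" and max: "\<nexists>y. y \<in> directions x \<and> card (?Z e) < card (?Z y)"
    obtain r where r: "r \<in> tight_rows S" "improving x S (lvl r)" "0 < slack S e (lvl r)"
      using direction_slack[OF x e] by blast
    obtain f where f: "f \<in> directions x"
      "\<And>k. k \<in> {1..n} \<Longrightarrow> slack S f k = (if k = lvl r then 1 else 0)"
      using obtain_edge[OF x r(2)] by blast
    have "\<forall>s\<in>tight_rows S. slack S f (lvl s) \<noteq> 0 \<longleftrightarrow> s = r"
      using f(2) lvl_bounds lvl_inj_rows r(1) by auto
    then have "card (?Z f) = card (tight_rows S) - 1"
      using single[OF r(1)] by blast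
    moreover have "\<not> card (?Z e) < card (?Z f)"
      using max f(1) by blast
    moreover have "card (tight_rows S - ?Z e) = card (tight_rows S) - card (?Z e)"
      by (intro card_Diff_subset) auto
    ultimately have "card (tight_rows S - ?Z e) \<le> Suc 0"
      by linarith
    then have unique: "s = r" if "s \<in> tight_rows S" "slack S e (lvl s) \<noteq> 0" for s
      using that r by (subst (asm) card_le_Suc0_iff_eq) auto
    show "\<exists>r\<in>tight_rows S. \<forall>s\<in>tight_rows S. slack S e (lvl s) \<noteq> 0 \<longleftrightarrow> s = r"
    proof (intro bexI[OF _ r(1)] ballI iffI)
      fix s assume "s \<in> tight_rows S" "slack S e (lvl s) \<noteq> 0"
      then show "s = r"
        by (rule unique)
    next
      fix s assume "s = r"
      then show "slack S e (lvl s) \<noteq> 0"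
        using r(3) by simp
    qed
  next
    assume "\<exists>r\<in>tight_rows S. \<forall>s\<in>tight_rows S. slack S e (lvl s) \<noteq> 0 \<longleftrightarrow> s = r"
    then have "card (?Z e) = card (tight_rows S) - 1"
      using single by blast
    then show "\<nexists>y. y \<in> directions x \<and> card (?Z e) < card (?Z y)"
      using less by fastforce
  qed
qed

text \<open>The edge of the removed row is improving and keeps all remaining rows tight. The maximum
  is therefore the full count, and every maximizer follows that edge.\<close>

lemma arg_max_minus_row:
  assumes x: "vertex x S" and r: "r \<in> tight_rows S" "improving x S (lvl r)"
  shows "is_arg_max (\<lambda>e. card {k \<in> tight_rows S - {r}. (cube_matrix *v e) $ k = 0}) (\<lambda>e. e \<in> directions x) e \<longleftrightarrow>
    e \<in> directions x \<and> (\<forall>s\<in>tight_rows S - {r}. slack S e (lvl s) = 0)"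
proof -
  let ?Z = "\<lambda>e. {s \<in> tight_rows S - {r}. slack S e (lvl s) = 0}"
  have zero: "{k \<in> tight_rows S - {r}. (cube_matrix *v e) $ k = 0} = ?Z e" for e
    by (rule zero_rows) auto
  obtain f where f: "f \<in> directions x"
    "\<And>k. k \<in> {1..n} \<Longrightarrow> slack S f k = (if k = lvl r then 1 else 0)"
    using obtain_edge[OF x r(2)] by blast
  have full: "?Z f = tight_rows S - {r}"
    using f(2) lvl_bounds lvl_inj_rows r(1) by auto
  have le: "card (?Z e) \<le> card (tight_rows S - {r})" for e
    by (rule card_mono) auto
  show ?thesis
    unfolding is_arg_max_def zero
  proof (intro conj_cong iffI refl)
    assume "\<nexists>y. y \<in> directions x \<and> card (?Z e) < card (?Z y)"
    then have "\<not> card (?Z e) < card (?Z f)"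
      using f(1) by blast
    then have "card (tight_rows S - {r}) \<le> card (?Z e)"
      unfolding full by (rule leI)
    then have "?Z e = tight_rows S - {r}"
      by (intro card_seteq) auto
    then show "\<forall>s\<in>tight_rows S - {r}. slack S e (lvl s) = 0"
      by blast
  next
    assume "\<forall>s\<in>tight_rows S - {r}. slack S e (lvl s) = 0"
    then have "?Z e = tight_rows S - {r}"
      by blast
    then have "\<not> card (?Z e) < card (?Z y)" for y
      using le[of y] by (simp only: not_less)
    then show "\<nexists>y. y \<in> directions x \<and> card (?Z e) < card (?Z y)"
      by blast
  qed
qed

text \<open>A maximizing direction loosens a single row, so the row to remove is forced by the
  direction; the branch that moves cannot occur.\<close>

lemma admissible_full:
  assumes x: "vertex x S"
  shows "admissible_choice objective cube_matrix cube_bound (x, tight_rows S) (e, r, j) \<longleftrightarrow>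
    e \<in> directions x \<and> r \<in> tight_rows S \<and> (\<forall>s\<in>tight_rows S. slack S e (lvl s) \<noteq> 0 \<longleftrightarrow> s = r)"
    (is "?L \<longleftrightarrow> ?R")
proof
  assume ?L
  then have e: "e \<in> directions x" and "\<exists>r\<in>tight_rows S. \<forall>s\<in>tight_rows S. slack S e (lvl s) \<noteq> 0 \<longleftrightarrow> s = r"
    and *: "if \<exists>k\<in>tight_rows S. (cube_matrix *v e) $ k \<noteq> 0
      then r \<in> tight_rows S \<and> (cube_matrix *v e) $ r < 0
      else gradient objective (move objective cube_matrix cube_bound x e) \<bullet> e > 0 \<longrightarrow>
        j \<in> tight cube_matrix cube_bound (move objective cube_matrix cube_bound x e) - tight_rows S"
    unfolding admissible_choice.simps arg_max_full[OF x] by blast+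
  then obtain q where q: "q \<in> tight_rows S" "\<forall>s\<in>tight_rows S. slack S e (lvl s) \<noteq> 0 \<longleftrightarrow> s = q"
    by blast
  then have "\<exists>k\<in>tight_rows S. (cube_matrix *v e) $ k \<noteq> 0"
    by (auto simp: row_direction)
  then have "r \<in> tight_rows S" "(cube_matrix *v e) $ r < 0"
    using * by simp_all
  then have "r \<in> tight_rows S" "slack S e (lvl r) \<noteq> 0"
    by (simp_all add: row_direction)
  moreover from this have "r = q"
    using q(2) by blast
  ultimately show ?R
    using e q by blast
next
  assume R: ?R
  then have "0 \<le> slack S e (lvl r)" "slack S e (lvl r) \<noteq> 0"
    using mem_directions_iff[OF x] by blast+
  moreover have r: "r \<in> tight_rows S"
    using R by blast
  ultimately have neg: "(cube_matrix *v e) $ r < 0"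
    by (simp add: row_direction)
  then have "\<exists>k\<in>tight_rows S. (cube_matrix *v e) $ k \<noteq> 0"
    using r by (metis less_irrefl)
  then show ?L
    unfolding admissible_choice.simps arg_max_full[OF x] using R r neg by (simp only: if_True) blast
qed

text \<open>Existence of a choice matters because \<open>pivot_rule\<close> constrains the rule only
  where an admissible choice exists.\<close>

lemma step_full:
  assumes x: "vertex x S" and "directions x \<noteq> {}"
  shows "\<exists>ch. admissible_choice objective cube_matrix cube_bound (x, tight_rows S) ch"
    and "admissible_choice objective cube_matrix cube_bound (x, tight_rows S) ch \<Longrightarrow>
      \<exists>r\<in>tight_rows S. improving x S (lvl r) \<and>
        iteration objective cube_matrix cube_bound ch (x, tight_rows S) = (x, tight_rows S - {r})"
proof -
  obtain e where e: "e \<in> directions x"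
    using assms(2) by blast
  obtain r where r: "r \<in> tight_rows S" "improving x S (lvl r)"
    using direction_slack[OF x e] by blast
  obtain f where f: "f \<in> directions x"
    "\<And>k. k \<in> {1..n} \<Longrightarrow> slack S f k = (if k = lvl r then 1 else 0)"
    using obtain_edge[OF x r(2)] by blast
  have "\<forall>s\<in>tight_rows S. slack S f (lvl s) \<noteq> 0 \<longleftrightarrow> s = r"
    using f(2) lvl_bounds lvl_inj_rows r(1) by auto
  then show "\<exists>ch. admissible_choice objective cube_matrix cube_bound (x, tight_rows S) ch"
    using admissible_full[OF x, of f r] f(1) r(1) by blast
next
  assume ch: "admissible_choice objective cube_matrix cube_bound (x, tight_rows S) ch"
  obtain e r j where eq: "ch = (e, r, j)"
    by (rule prod_cases3)
  have e: "e \<in> directions x" and r: "r \<in> tight_rows S"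
    and single: "\<forall>s\<in>tight_rows S. slack S e (lvl s) \<noteq> 0 \<longleftrightarrow> s = r"
    using ch admissible_full[OF x] unfolding eq by blast+
  obtain q where "q \<in> tight_rows S" "improving x S (lvl q)" "0 < slack S e (lvl q)"
    using direction_slack[OF x e] by blast
  moreover from this have "q = r"
    using single by (metis less_irrefl)
  ultimately have "improving x S (lvl r)"
    by simp
  moreover have "slack S e (lvl r) \<noteq> 0"
    using r single by blast
  then have "\<exists>k\<in>tight_rows S. (cube_matrix *v e) $ k \<noteq> 0"
    using r by (intro bexI[of _ r]) (simp_all add: row_direction)
  ultimately show "\<exists>r\<in>tight_rows S. improving x S (lvl r) \<and>
      iteration objective cube_matrix cube_bound ch (x, tight_rows S) = (x, tight_rows S - {r})"
    using r by (auto simp: eq)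
qed

text \<open>The objective is convex, so the slope along \<open>e\<close> stays positive and only the
  boundary of the cube ends the step. This happens at the adjacent vertex, where level
  \<open>i\<close> has switched to its other constraint. The slope is still positive there, so the
  method adds a row.\<close>

lemma move_edge:
  assumes x: "vertex x S" and e: "e \<in> directions x" and imp: "improving x S i"
    and zero: "\<And>k. k \<in> {1..n} \<Longrightarrow> k \<noteq> i \<Longrightarrow> slack S e k = 0"
    and y: "y = move objective cube_matrix cube_bound x e"
    and T: "T = (if i \<in> S then S - {i} else insert i S)"
  shows "vertex y T" "coord y n = coord x n + gap x i" "0 < gradient objective y \<bullet> e"
proof -
  note i = improvingD[OF x imp]
  obtain r where r: "r \<in> tight_rows S" "0 < slack S e (lvl r)"
    using direction_slack[OF x e] by blast
  have "lvl r = i"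
    using zero[of "lvl r"] r(2) lvl_bounds[of r] by force
  with r have s: "0 < slack S e i"
    by simp
  \<comment> \<open>The two bounds of level \<open>i\<close> are 1 - 2 \<epsilon> x_(i-1) apart, and
    the slack is the speed at which the edge crosses from one to the other.\<close>
  define \<mu> where "\<mu> = (1 - 2 * \<epsilon> * coord x (i - 1)) / slack S e i"
  have \<mu>s: "\<mu> * slack S e i = 1 - 2 * \<epsilon> * coord x (i - 1)"
    using s by (simp add: \<mu>_def)
  have less: "0 < 1 - 2 * \<epsilon> * coord x (i - 1)"
    using eps_coord_less[OF x, of "i - 1"] i(1) by fastforce
  have \<mu>: "0 < \<mu>"
    using s less by (simp add: \<mu>_def)
  define z where "z = x + \<mu> *\<^sub>R e"
  \<comment> \<open>Levels below \<open>i\<close> have no slack, so neither these coordinates nor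
    the bounds of level \<open>i\<close> change along the edge.\<close>
  have below: "coord e (i - 1) = 0"
    unfolding coord_eq_sum[of e "i - 1" S] using i(1) zero by (intro sum.neutral) auto
  have slack_line: "sig S i * coord (x + t *\<^sub>R e) i = sig S i * coord x i + t * slack S e i" for t
    unfolding coord_add coord_scaleR slack_def below by (simp add: algebra_simps)
  have xi: "coord x i = (if i \<in> S then 1 - \<epsilon> * coord x (i - 1) else \<epsilon> * coord x (i - 1))"
    using x i(1) unfolding vertex_def by blast
  have z: "vertex z T"
    unfolding vertex_def
  proof
    fix k assume k: "k \<in> {1..n}"
    show "coord z k = (if k \<in> T then 1 - \<epsilon> * coord z (k - 1) else \<epsilon> * coord z (k - 1))"
    proof (cases "k = i")
      case True
      have "coord z (i - 1) = coord x (i - 1)"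
        unfolding z_def coord_add coord_scaleR below by simp
      moreover have "sig S i * coord z i = sig S i * coord x i + (1 - 2 * \<epsilon> * coord x (i - 1))"
        using slack_line[of \<mu>] \<mu>s by (simp add: z_def)
      ultimately show ?thesis
        using xi True by (auto simp: T sig_def split: if_splits)
    next
      case False
      have "coord x k = (if k \<in> S then 1 - \<epsilon> * coord x (k - 1) else \<epsilon> * coord x (k - 1))"
        using x k unfolding vertex_def by blast
      moreover have "coord e k = sig S k * (\<epsilon> * coord e (k - 1))"
        using coord_eq_slack[of e k S] zero[OF k False] by simp
      moreover have "k \<in> T \<longleftrightarrow> k \<in> S"
        using False by (simp add: T)
      ultimately show ?thesis
        by (simp add: z_def coord_add coord_scaleR sig_def algebra_simps)
    qed
  qed
  have slope: "0 < gradient objective (x + t *\<^sub>R e) \<bullet> e" if "0 \<le> t" for t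
  proof -
    have "gradient objective (x + t *\<^sub>R e) \<bullet> e = gradient objective x \<bullet> e + 2 * t * (coord e n)\<^sup>2"
      by (simp add: gradient_objective coord_add coord_scaleR power2_eq_square algebra_simps)
    moreover have "0 < gradient objective x \<bullet> e"
      using e mem_directions_iff[OF x] by blast
    ultimately show ?thesis
      using that by (simp add: add_pos_nonneg)
  qed
  have inside: "x + t *\<^sub>R e \<in> cube" if "0 \<le> t" "t \<le> \<mu>" for t
  proof -
    have "convex cube"
      using polytope_cube polytope_imp_convex by blast
    moreover have "x + t *\<^sub>R e = (1 - t / \<mu>) *\<^sub>R x + (t / \<mu>) *\<^sub>R z"
      using \<mu> by (simp add: z_def algebra_simps)
    ultimately show ?thesis
      using vertex_mem_cube[OF x] vertex_mem_cube[OF z] that \<mu> by (simp add: convexD_alt)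
  qed
  have outside: "x + t *\<^sub>R e \<notin> cube" if "\<mu> < t" for t
  proof
    assume "x + t *\<^sub>R e \<in> cube"
    then have "\<epsilon> * coord (x + t *\<^sub>R e) (i - 1) \<le> coord (x + t *\<^sub>R e) i"
      "coord (x + t *\<^sub>R e) i \<le> 1 - \<epsilon> * coord (x + t *\<^sub>R e) (i - 1)"
      using i(1) unfolding mem_cube_iff by blast+
    moreover have "coord (x + t *\<^sub>R e) (i - 1) = coord x (i - 1)"
      unfolding coord_add coord_scaleR below by simp
    moreover have "1 - 2 * \<epsilon> * coord x (i - 1) < t * slack S e i"
      using that s \<mu>s by (metis mult_strict_right_mono)
    ultimately show False
      using slack_line[of t] xi by (cases "i \<in> S") (simp_all add: sig_def)
  qed
  \<comment> \<open>The set is an open ray: its infimum is not attained, and the step ends exactly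
    at the vertex.\<close>
  have "{t. t \<ge> 0 \<and> (x + t *\<^sub>R e \<notin> cube \<or> gradient objective (x + t *\<^sub>R e) \<bullet> e \<le> 0)} = {\<mu><..}"
    using inside outside slope \<mu> by (force simp: not_le)
  then have "step_length objective cube_matrix cube_bound x e = \<mu>"
    by (simp add: step_length_def)
  then have yz: "y = z"
    by (simp add: y move_def z_def)
  show "vertex y T"
    using z yz by simp
  show "0 < gradient objective y \<bullet> e"
    using slope[of \<mu>] \<mu> by (simp add: yz z_def)
  have "coord e n = (\<Sum>k=1..n. if k = i then orient S n i * \<epsilon> ^ (n - i) * slack S e i else 0)"
    unfolding coord_eq_sum[of e n S] by (rule sum.cong) (auto simp: zero)
  also have "\<dots> = \<epsilon> ^ (n - i) * slack S e i"
    using i by simp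
  finally have "\<mu> * coord e n = gap x i"
    unfolding gap_def \<mu>s[symmetric] by simp
  then show "coord y n = coord x n + gap x i"
    by (simp add: yz z_def coord_add coord_scaleR)
qed

text \<open>The move makes just one new row tight, the opposite row \<open>q\<close> of the same
  level. Adding it is forced and makes the active set the full set of tight rows again, so moves and
  removals alternate.\<close>

lemma step_minus_row:
  assumes x: "vertex x S" and r: "r \<in> tight_rows S" "improving x S (lvl r)"
  shows "\<exists>ch. admissible_choice objective cube_matrix cube_bound (x, tight_rows S - {r}) ch"
    and "admissible_choice objective cube_matrix cube_bound (x, tight_rows S - {r}) ch \<Longrightarrow>
      \<exists>y T. vertex y T \<and> coord y n = coord x n + gap x (lvl r) \<and>
        iteration objective cube_matrix cube_bound ch (x, tight_rows S - {r}) = (y, tight_rows T)"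
proof -
  define T where "T = (if lvl r \<in> S then S - {lvl r} else insert (lvl r) S)"
  obtain q where q: "lvl q = lvl r" "up q = (\<not> up r)"
    using obtain_row[of "lvl r"] lvl_bounds[of r] by auto
  have rows_T: "tight_rows T = insert q (tight_rows S - {r})"
  proof -
    have "s \<in> tight_rows T \<longleftrightarrow> s \<in> insert q (tight_rows S - {r})" for s
      using r(1) q row_eqI[of s q] row_eqI[of s r] by (auto simp: tight_rows_def T_def)
    then show ?thesis
      by blast
  qed
  have q_notin: "q \<notin> tight_rows S - {r}"
    using q r(1) by (auto simp: tight_rows_def)
  let ?move = "move objective cube_matrix cube_bound x"
  have edge: "vertex (?move e) T \<and> coord (?move e) n = coord x n + gap x (lvl r) \<and>
      0 < gradient objective (?move e) \<bullet> e \<and>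
      \<not> (\<exists>k\<in>tight_rows S - {r}. (cube_matrix *v e) $ k \<noteq> 0)"
    if e: "e \<in> directions x" "\<forall>s\<in>tight_rows S - {r}. slack S e (lvl s) = 0" for e
  proof -
    have "slack S e k = 0" if k: "k \<in> {1..n}" "k \<noteq> lvl r" for k
    proof -
      obtain s where "s \<in> tight_rows S" "lvl s = k"
        using obtain_row_in_rows[OF k(1)] .
      then show ?thesis
        using e(2) k(2) by auto
    qed
    from move_edge[OF x e(1) r(2) this refl T_def]
    show ?thesis
      using e(2) by (auto simp: row_direction)
  qed
  have adm: "admissible_choice objective cube_matrix cube_bound (x, tight_rows S - {r}) (e, i, j) \<longleftrightarrow>
      e \<in> directions x \<and> (\<forall>s\<in>tight_rows S - {r}. slack S e (lvl s) = 0) \<and> j = q" for e i j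
  proof -
    have "tight cube_matrix cube_bound (?move e) - (tight_rows S - {r}) = {q}"
      if "e \<in> directions x" "\<forall>s\<in>tight_rows S - {r}. slack S e (lvl s) = 0"
      using edge[OF that] tight_vertex[of "?move e" T] q_notin by (auto simp: rows_T)
    then show ?thesis
      unfolding admissible_choice.simps arg_max_minus_row[OF x r] using edge[of e] by auto
  qed
  obtain f where f: "f \<in> directions x"
    "\<And>k. k \<in> {1..n} \<Longrightarrow> slack S f k = (if k = lvl r then 1 else 0)"
    using obtain_edge[OF x r(2)] by blast
  have "\<forall>s\<in>tight_rows S - {r}. slack S f (lvl s) = 0"
    using f(2) lvl_bounds lvl_inj_rows r(1) by auto
  then show "\<exists>ch. admissible_choice objective cube_matrix cube_bound (x, tight_rows S - {r}) ch"
    using adm f(1) by blast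
  show "\<exists>y T. vertex y T \<and> coord y n = coord x n + gap x (lvl r) \<and>
      iteration objective cube_matrix cube_bound ch (x, tight_rows S - {r}) = (y, tight_rows T)"
    if ch: "admissible_choice objective cube_matrix cube_bound (x, tight_rows S - {r}) ch"
  proof -
    obtain e i j where eq: "ch = (e, i, j)"
      by (rule prod_cases3)
    have e: "e \<in> directions x" "\<forall>s\<in>tight_rows S - {r}. slack S e (lvl s) = 0" and "j = q"
      using ch adm unfolding eq by blast+
    note edge[OF e]
    moreover from this have "iteration objective cube_matrix cube_bound ch (x, tight_rows S - {r}) = (?move e, tight_rows T)"
      unfolding eq iteration.simps rows_T \<open>j = q\<close> by simp
    ultimately show ?thesis
      by blast
  qed
qed

section \<open>Counting the iterations\<close>

text \<open>The potential \<open>2 * coord x n\<close>, increased by \<open>c\<close> while a row is missing from the active set, grows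
  by at most \<open>c\<close> in each iteration; this gives the lower bound on the number of iterations. The same
  potential with the least possible gap in place of \<open>c\<close> grows by at least that gap, which gives
  termination.\<close>

definition reachable :: "nat \<Rightarrow> ('n, 'm) state \<Rightarrow> bool" where
  "reachable k s \<longleftrightarrow> (\<exists>x \<A> S. s = (x, \<A>) \<and> vertex x S \<and>
    (\<A> = tight_rows S \<and>
       2 * coord x n \<le> k * c \<and> k * (\<epsilon> ^ n * (1 - 2 * \<epsilon>)) \<le> 2 * coord x n \<or>
     (\<exists>r\<in>tight_rows S. improving x S (lvl r) \<and> \<A> = tight_rows S - {r} \<and>
       2 * coord x n + c \<le> k * c \<and>
       k * (\<epsilon> ^ n * (1 - 2 * \<epsilon>)) \<le> 2 * coord x n + \<epsilon> ^ n * (1 - 2 * \<epsilon>))))"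

lemma reachable_step:
  assumes "reachable k s" "directions (fst s) \<noteq> {}"
  shows "\<exists>ch. admissible_choice objective cube_matrix cube_bound s ch"
    and "admissible_choice objective cube_matrix cube_bound s ch \<Longrightarrow>
      reachable (Suc k) (iteration objective cube_matrix cube_bound ch s)"
proof -
  define \<gamma> where "\<gamma> = \<epsilon> ^ n * (1 - 2 * \<epsilon>)"
  obtain x \<A> S where s: "s = (x, \<A>)" and x: "vertex x S" and
    cases: "\<A> = tight_rows S \<and> 2 * coord x n \<le> k * c \<and> k * \<gamma> \<le> 2 * coord x n \<or>
     (\<exists>r\<in>tight_rows S. improving x S (lvl r) \<and> \<A> = tight_rows S - {r} \<and>
       2 * coord x n + c \<le> k * c \<and> k * \<gamma> \<le> 2 * coord x n + \<gamma>)"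
    using assms(1) unfolding reachable_def \<gamma>_def by blast
  have D: "directions x \<noteq> {}"
    using assms(2) by (simp add: s)
  show "\<exists>ch. admissible_choice objective cube_matrix cube_bound s ch"
    using cases step_full(1)[OF x D] step_minus_row(1)[OF x] unfolding s by blast
  show "reachable (Suc k) (iteration objective cube_matrix cube_bound ch s)"
    if adm: "admissible_choice objective cube_matrix cube_bound s ch"
    using cases
  proof (elim disjE conjE bexE)
    assume \<A>: "\<A> = tight_rows S" and k: "2 * coord x n \<le> k * c" "k * \<gamma> \<le> 2 * coord x n"
    obtain r where "r \<in> tight_rows S" "improving x S (lvl r)"
      "iteration objective cube_matrix cube_bound ch s = (x, tight_rows S - {r})"
      using step_full(2)[OF x D] adm unfolding s \<A> by blast
    moreover have "2 * coord x n + c \<le> Suc k * c" "Suc k * \<gamma> \<le> 2 * coord x n + \<gamma>"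
      using k by (simp_all add: algebra_simps)
    ultimately show ?thesis
      using x unfolding reachable_def \<gamma>_def by blast
  next
    fix r assume r: "r \<in> tight_rows S" "improving x S (lvl r)" and \<A>: "\<A> = tight_rows S - {r}"
      and k: "2 * coord x n + c \<le> k * c" "k * \<gamma> \<le> 2 * coord x n + \<gamma>"
    obtain y T where y: "vertex y T" "coord y n = coord x n + gap x (lvl r)"
      and it: "iteration objective cube_matrix cube_bound ch s = (y, tight_rows T)"
      using step_minus_row(2)[OF x r] adm unfolding s \<A> by blast
    \<comment> \<open>The move adds twice the gap to the potential \<open>2 * coord x n\<close>. The
      preceding removal was already charged one half of this, and the move is charged the other
      half.\<close>
    have "gap x (lvl r) < c" "\<gamma> \<le> gap x (lvl r)"
      using improvingD[OF x r(2)] gap_bounds[OF x] by (auto simp: \<gamma>_def)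
    then have "2 * coord y n \<le> Suc k * c" "Suc k * \<gamma> \<le> 2 * coord y n"
      using k y(2) by (simp_all add: algebra_simps)
    then show ?thesis
      using y(1) it unfolding reachable_def \<gamma>_def by blast
  qed
qed

text \<open>The lower bound on the potential forces a stop, as x_n never exceeds 1. By
  \<open>directions_nonempty\<close> the stop is at x_n = 1, where the objective attains its upper
  bound \<open>c\<close>, and the upper bound on the potential yields the count.\<close>

lemma active_set_iterations:
  assumes R: "pivot_rule objective cube_matrix cube_bound R"
  shows "\<exists>N y. active_set_terminates objective cube_matrix cube_bound R 0 N y \<and>
    is_arg_max objective (\<lambda>z. z \<in> cube) y \<and> 2 \<le> N * c"
proof -
  let ?h = "active_set_history objective cube_matrix cube_bound R 0"
  let ?pt = "active_set_point objective cube_matrix cube_bound R 0"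
  define \<gamma> where "\<gamma> = \<epsilon> ^ n * (1 - 2 * \<epsilon>)"
  have \<gamma>: "0 < \<gamma>"
    using eps_pos eps_half by (simp add: \<gamma>_def)
  have nonempty: "?h k \<noteq> []" for k
    by (cases k) (simp_all add: Let_def)
  have zero: "coord 0 i = 0" for i
    by (simp add: coord_def)
  have reach: "reachable k (last (?h k))" if "\<forall>j<k. directions (?pt j) \<noteq> {}" for k
    using that
  proof (induction k)
    case 0
    have "vertex 0 {}"
      by (simp add: vertex_def zero)
    moreover from this have "last (?h 0) = (0, tight_rows {})"
      by (simp add: tight_vertex)
    ultimately show ?case
      unfolding reachable_def by (auto simp: zero intro!: exI[of _ "{}"])
  next
    case (Suc k)
    then have k: "reachable k (last (?h k))" "directions (fst (last (?h k))) \<noteq> {}"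
      by (auto simp: active_set_point_def)
    have "admissible_choice objective cube_matrix cube_bound (last (?h k)) (R (?h k))"
      using R nonempty reachable_step(1)[OF k] unfolding pivot_rule_def by blast
    then show ?case
      using reachable_step(2)[OF k] by (simp add: Let_def)
  qed
  \<comment> \<open>Weakened bounds that hold whether or not a row is missing from the active
    set.\<close>
  have point: "\<exists>S. vertex (?pt k) S \<and> (2 * coord (?pt k) n \<le> k * c) \<and> k * \<gamma> \<le> 2 * coord (?pt k) n + \<gamma>"
    if "\<forall>j<k. directions (?pt j) \<noteq> {}" for k
    using reach[OF that] \<gamma> c_pos unfolding reachable_def active_set_point_def \<gamma>_def[symmetric] by fastforce
  have "\<exists>N. directions (?pt N) = {}"
  proof (rule ccontr)
    assume never: "\<not> ?thesis"
    obtain k :: nat where k: "2 + \<gamma> < k * \<gamma>"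
      using reals_Archimedean3[OF \<gamma>] by blast
    obtain S where "vertex (?pt k) S" "k * \<gamma> \<le> 2 * coord (?pt k) n + \<gamma>"
      using point[of k] never by blast
    then show False
      using k vertex_bounds(2)[of "?pt k" S n] by simp
  qed
  then obtain N where N: "directions (?pt N) = {}" and before: "\<forall>k<N. directions (?pt k) \<noteq> {}"
    using exists_least_iff[of "\<lambda>N. directions (?pt N) = {}"] by blast
  obtain S where S: "vertex (?pt N) S" and le: "2 * coord (?pt N) n \<le> N * c"
    using point[OF before] by blast
  have one: "coord (?pt N) n = 1"
    using directions_nonempty[OF S] N by blast
  have "active_set_terminates objective cube_matrix cube_bound R 0 N (?pt N)"
    using N before by (simp add: active_set_terminates_def)
  moreover have "is_arg_max objective (\<lambda>z. z \<in> cube) (?pt N)"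
    using vertex_mem_cube[OF S] objective_le objective_vertex[OF S] one
    by (auto simp: is_arg_max_def not_less)
  moreover have "2 \<le> N * c"
    using le one by simp
  ultimately show ?thesis
    by blast
qed

end

section \<open>Choice of the parameters\<close>

theorem theorem1p1:
  fixes d :: nat
  assumes "even d" and "d > 0"
    and "CARD('n::finite) = d" and "CARD('m::finite) = 2 * d"
  shows "\<exists>(A :: real^'n^'m) (b :: real^'m) (f :: real^'n \<Rightarrow> real).
    (\<forall>i j. A $ i $ j \<in> \<rat>) \<and> (\<forall>i. b $ i \<in> \<rat>) \<and>
    polytope (feasible A b) \<and>
    card {F. F facet_of feasible A b} = 2 * d \<and>
    quadratic_polynomial f \<and> convex_on UNIV f \<and>
    (\<exists>x. x extreme_point_of feasible A b \<and>
      (\<forall>R. pivot_rule f A b R \<longrightarrow>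
        (\<exists>N y. active_set_terminates f A b R x N y \<and>
               is_arg_max f (\<lambda>z. z \<in> feasible A b) y \<and>
               N \<ge> 2 ^ d)))"
proof -
  \<comment> \<open>Evenness excludes \<open>d = 1\<close>, where
    \<open>\<epsilon> ^ (d - 1)\<close> and \<open>c\<close> would both be 1 and
    \<open>gap_first\<close> would fail.\<close>
  have d: "2 \<le> d"
    using assms(1,2) by (auto elim: evenE)
  \<comment> \<open>A rational number below 1/2 with 1 - 2 \<epsilon> = 2^(-d), half of
    \<open>c\<close>. With this \<open>c\<close>, the bound \<open>2 \<le> N * c\<close> becomes N
    >= 2^d.\<close>
  define \<epsilon> :: real where "\<epsilon> = 1/2 - 1 / 2 ^ Suc d"
  define c :: real where "c = 1 / 2 ^ (d - 1)"
  have "(2::real) ^ Suc d \<ge> 2 ^ 3"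
    using d by (intro power_increasing) auto
  then have \<epsilon>: "0 < \<epsilon>" "\<epsilon> < 1/2"
    by (auto simp: \<epsilon>_def field_simps)
  have gap_first: "\<epsilon> ^ (d - 1) < c"
    using power_strict_mono[of \<epsilon> "1/2" "d - 1"] \<epsilon> d by (simp add: c_def power_divide)
  have "(2::real) ^ (d - 1) < 2 ^ d"
    using d by (intro power_strict_increasing) auto
  then have gap_top: "1 - 2 * \<epsilon> < c"
    by (simp add: \<epsilon>_def c_def field_simps)
  obtain pos :: "'n \<Rightarrow> nat" where pos: "bij_betw pos UNIV {1..d}"
    using bij_betw_iff_card[of "UNIV :: 'n set" "{1..d}"] assms(3) by auto
  obtain g :: "'m \<Rightarrow> nat \<times> bool" where g: "bij_betw g UNIV ({1..d} \<times> UNIV)"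
    using bij_betw_iff_card[of "UNIV :: 'm set" "{1..d} \<times> (UNIV :: bool set)"] assms(4) by auto
  interpret klee_minty pos "\<lambda>r. fst (g r)" "\<lambda>r. snd (g r)" d \<epsilon> c
    using pos g assms(2) \<epsilon> gap_first gap_top by unfold_locales simp_all
  have "\<epsilon> \<in> \<rat>"
    unfolding \<epsilon>_def by (intro Rats_diff Rats_divide Rats_power) auto
  then have "cube_matrix $ i $ j \<in> \<rat>" "cube_bound $ i \<in> \<rat>" for i j
    by (auto simp: cube_matrix_def cube_bound_def)
  moreover have "card {F. F facet_of cube} = 2 * d"
    using card_facets_cube assms(4) by simp
  moreover have "\<exists>N y. active_set_terminates objective cube_matrix cube_bound R 0 N y \<and>
      is_arg_max objective (\<lambda>z. z \<in> cube) y \<and> 2 ^ d \<le> N"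
    if R: "pivot_rule objective cube_matrix cube_bound R" for R
  proof -
    obtain N y where N: "active_set_terminates objective cube_matrix cube_bound R 0 N y"
      "is_arg_max objective (\<lambda>z. z \<in> cube) y" "2 \<le> N * c"
      using active_set_iterations[OF R] by blast
    have "(2::real) ^ d = 2 * 2 ^ (d - 1)"
      using assms(2) by (simp flip: power_Suc)
    also have "\<dots> \<le> N"
      using N(3) by (simp add: c_def field_simps)
    finally have "2 ^ d \<le> N"
      by (metis of_nat_le_iff of_nat_numeral of_nat_power)
    then show ?thesis
      using N by blast
  qed
  ultimately show ?thesis
    using polytope_cube quadratic_polynomial_objective convex_objective extreme_point_zero
    by (intro exI[of _ cube_matrix] exI[of _ cube_bound] exI[of _ objective] conjI exI[of _ 0]) auto
qed

end
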